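(* Let $\mathbb{F}=\mathbb{R}$ or $\mathbb{C}$, let $\eta\ge 1$ be an integer and let $x_1,\dots,x_\eta$ be different values in $\mathbb{F}$. For each $j\in\{2,\dots,\eta+1\}$, consider the polynomial of degree $\eta$ $$a(x)=-(x-x_1)^{\eta+2-j}(x-x_2)\cdots(x-x_{j-1}).$$ Then the differential equation $a(x)\dot y=\dot a(x)\,y+y^2$ has exactly $j$ polynomial solutions.
   Context: The dot denotes $d/dx$. A polynomial solution is a polynomial $y\in\mathbb{F}[x]$ (including the zero polynomial) satisfying the equation identically. For $j=2$ the product defining $a$ is understood as $a(x)=-(x-x_1)^{\eta}$. *)

theory Defs
  imports "HOL-Analysis.Analysis" "HOL-Computational_Algebra.Polynomial"
begin

text \<open>
  The points are \<open>x 1, \<dots>, x \<eta>\<close>; other values of \<open>x\<close> are irrelevant. The index set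
  \<open>{2..j - 1}\<close> is empty for \<open>j = 2\<close>, so that \<open>coeff_a x \<eta> 2\<close> is the negated \<open>\<eta>\<close>-th power of
  the linear factor at \<open>x 1\<close>. Subtraction on \<open>nat\<close> does not truncate for \<open>2 \<le> j \<le> \<eta> + 1\<close>.
\<close>

definition coeff_a :: "(nat \<Rightarrow> 'a::field) \<Rightarrow> nat \<Rightarrow> nat \<Rightarrow> 'a poly" where
  "coeff_a x \<eta> j = - ([:- x 1, 1:] ^ (\<eta> + 2 - j) * (\<Prod>i = 2..j - 1. [:- x i, 1:]))"

definition polynomial_solution :: "'a::field poly \<Rightarrow> 'a poly \<Rightarrow> bool" where
  "polynomial_solution a y \<longleftrightarrow> a * pderiv y = pderiv a * y + y\<^sup>2"

lemma degree_coeff_a: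
  assumes "2 \<le> j" "j \<le> \<eta> + 1"
  shows "degree (coeff_a x \<eta> j) = \<eta>"
proof -
  have "degree (\<Prod>i = 2..j - 1. [:- x i, 1:]) = (\<Sum>i = 2..j - 1. degree [:- x i, 1:])"
    by (rule degree_prod_eq_sum_degree) simp
  moreover have "(\<Prod>i = 2..j - 1. [:- x i, 1:]) \<noteq> 0"
    by simp
  ultimately show ?thesis
    using assms by (simp add: coeff_a_def degree_mult_eq degree_power_eq)
qed

end

theory Submission
  imports Defs "HOL-Computational_Algebra.Polynomial_Factorial"
    "HOL-Computational_Algebra.Field_as_Ring"
begin

text \<open>
  For \<open>y \<noteq> 0\<close> the equation says that \<open>a / y\<close> has derivative \<open>-1\<close>, so \<open>y = a / (r - x)\<close> for
  a constant \<open>r\<close>, and this is a polynomial exactly if \<open>r\<close> is a root of \<open>a\<close>. Hence the nonzero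
  solutions correspond to the distinct roots of \<open>a\<close>. To stay within polynomials, \<open>a\<close> and \<open>y\<close> are
  divided by their greatest common divisor; the equation then forces the remaining factor of \<open>y\<close>
  to divide its own derivative, that is, to be constant.
\<close>

lemma pderiv_eq_constD:
  fixes p :: "'a::field_char_0 poly"
  assumes "pderiv p = [:k:]"
  shows "\<exists>c. p = [:c, k:]"
proof -
  have "pderiv (p - [:0, k:]) = 0"
    using assms by (simp add: pderiv_diff pderiv_pCons)
  then obtain c where "p - [:0, k:] = [:c:]"
    using pderiv_eq_0_iff degree_eq_zeroE by metis
  then have "p = [:c, k:]"
    by (simp add: diff_eq_eq)
  then show ?thesis ..
qed

lemma polynomial_solution_0: "polynomial_solution a 0"
  by (simp add: polynomial_solution_def)

text \<open>The linear factor has derivative -1, so the product rule puts \<open>- y\<^sup>2\<close>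
  into \<open>pderiv a * y\<close>, and this cancels the quadratic term.\<close>

lemma polynomial_solution_quotient:
  "polynomial_solution (y * [:r, -1:]) y"
proof -
  have "pderiv [:r, -1:] = - 1"
    by (simp add: pderiv_pCons one_pCons)
  then show ?thesis
    by (simp add: polynomial_solution_def pderiv_mult algebra_simps power2_eq_square
        del: mult_pCons_right mult_pCons_left)
qed

lemma polynomial_solution_imp_quotient:
  fixes a y :: "'a::{field_char_0,field_gcd} poly"
  assumes sol: "polynomial_solution a y" and "y \<noteq> 0"
  shows "\<exists>r. a = y * [:r, -1:]"
proof -
  define g where "g = gcd a y"
  have "g \<noteq> 0"
    using \<open>y \<noteq> 0\<close> by (simp add: g_def)
  obtain A Y where a: "a = A * g" and y: "y = Y * g" and "coprime A Y"
    unfolding g_def using gcd_coprime_exists[of a y] \<open>y \<noteq> 0\<close> by auto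
  \<comment> \<open>By the product rule both sides contain \<open>A * Y * g * pderiv g\<close>; once
    this cancels, \<open>g\<^sup>2\<close> divides all that remains.\<close>
  have "g\<^sup>2 * (A * pderiv Y) = g\<^sup>2 * (Y * (pderiv A + Y))"
    using sol unfolding polynomial_solution_def a y
    by (simp add: pderiv_mult algebra_simps power2_eq_square)
  then have eq: "A * pderiv Y = Y * (pderiv A + Y)"
    using \<open>g \<noteq> 0\<close> by simp
  then have "Y dvd pderiv Y"
    using \<open>coprime A Y\<close> by (metis coprime_commute coprime_dvd_mult_right_iff dvd_triv_left)
  \<comment> \<open>In characteristic 0 a nonconstant polynomial has a nonzero derivative of smaller
    degree, which it cannot divide.\<close>
  then obtain k where k: "Y = [:k:]"
    using degree_eq_zeroE[of Y] by auto
  have "k \<noteq> 0"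
    using k y \<open>y \<noteq> 0\<close> by auto
  have "Y * (pderiv A + Y) = 0"
    using eq k by (simp add: pderiv_pCons)
  then have "pderiv A = [:- k:]"
    using k \<open>k \<noteq> 0\<close> by (simp add: add_eq_0_iff2)
  then obtain c where "A = [:c, - k:]"
    using pderiv_eq_constD by blast
  then have "A = Y * [:c / k, -1:]"
    using k \<open>k \<noteq> 0\<close> by simp
  then have "a = y * [:c / k, -1:]"
    by (simp add: a y mult_ac del: mult_pCons_right mult_pCons_left)
  then show ?thesis ..
qed

lemma card_polynomial_solutions:
  fixes a :: "'a::{field_char_0,field_gcd} poly"
  assumes "a \<noteq> 0"
  shows "card {y. polynomial_solution a y} = Suc (card {r. poly a r = 0})"
proof -
  define q where "q r = a div [:r, -1:]" for r
  have q: "a = q r * [:r, -1:]" if "poly a r = 0" for r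
  proof -
    have "[:- r, 1:] dvd a"
      using that by (simp add: poly_eq_0_iff_dvd)
    \<comment> \<open>The factor with derivative -1 is the negative of the monic one; a unit does
      not affect divisibility.\<close>
    then have "- [:- r, 1:] dvd a"
      by (simp only: minus_dvd_iff)
    then show ?thesis
      by (simp add: q_def del: mult_pCons_right)
  qed
  have "{y. polynomial_solution a y} = insert 0 (q ` {r. poly a r = 0})"
  proof (intro equalityI subsetI)
    fix y assume "y \<in> {y. polynomial_solution a y}"
    then have sol: "polynomial_solution a y" by simp
    show "y \<in> insert 0 (q ` {r. poly a r = 0})"
    proof (cases "y = 0")
      case False
      then obtain r where r: "a = y * [:r, -1:]"
        using polynomial_solution_imp_quotient[OF sol] by blast
      then have "poly a r = 0" "y = q r"
        by (simp_all add: q_def del: mult_pCons_right)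
      then show ?thesis by blast
    qed simp
  next
    fix y assume "y \<in> insert 0 (q ` {r. poly a r = 0})"
    then show "y \<in> {y. polynomial_solution a y}"
      using polynomial_solution_0 polynomial_solution_quotient q by (metis (mono_tags, lifting)
          image_iff insert_iff mem_Collect_eq)
  qed
  moreover have "0 \<notin> q ` {r. poly a r = 0}"
    using q \<open>a \<noteq> 0\<close> by force
  moreover have "inj_on q {r. poly a r = 0}"
  proof (rule inj_onI)
    fix r s assume "r \<in> {r. poly a r = 0}" "s \<in> {r. poly a r = 0}" and "q r = q s"
    \<comment> \<open>Both products equal \<open>a\<close>, so the common nonzero quotient can be
      cancelled.\<close>
    then have "q r * [:r, -1:] = q r * [:s, -1:]" "q r \<noteq> 0"
      using q[of r] q[of s] \<open>a \<noteq> 0\<close> by auto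
    then show "r = s"
      by (simp del: mult_pCons_right)
  qed
  ultimately show ?thesis
    using poly_roots_finite[OF \<open>a \<noteq> 0\<close>] by (simp add: card_image)
qed

lemma coeff_a_nonzero: "coeff_a x \<eta> j \<noteq> 0"
  by (simp add: coeff_a_def)

text \<open>The exponent \<open>\<eta> + 2 - j\<close> is at least 1, so \<open>x 1\<close> is
  always a root, even when the product is empty.\<close>

lemma roots_coeff_a:
  assumes "2 \<le> j" "j \<le> \<eta> + 1"
  shows "{r. poly (coeff_a x \<eta> j) r = 0} = x ` {1..j - 1}"
proof -
  have "{1..j - 1} = insert 1 {2..j - 1}"
    using assms by auto
  then show ?thesis
    using assms by (auto simp: coeff_a_def poly_prod)
qed

lemma card_polynomial_solutions_coeff_a:
  fixes x :: "nat \<Rightarrow> 'a::{field_char_0,field_gcd}"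
  assumes "2 \<le> j" "j \<le> \<eta> + 1" "inj_on x {1..\<eta>}"
  shows "card {y. polynomial_solution (coeff_a x \<eta> j) y} = j"
proof -
  have "inj_on x {1..j - 1}"
    by (rule inj_on_subset[OF assms(3)]) (use assms(2) in auto)
  \<comment> \<open>The \<open>j - 1\<close> distinct roots and the zero solution add up to
    \<open>j\<close>.\<close>
  then show ?thesis
    using assms by (simp add: card_polynomial_solutions[OF coeff_a_nonzero] roots_coeff_a card_image)
qed

theorem proposition10:
  fixes \<eta> j :: nat
  assumes "1 \<le> \<eta>" and "2 \<le> j" and "j \<le> \<eta> + 1"
  shows "(\<forall>x :: nat \<Rightarrow> real. inj_on x {1..\<eta>} \<longrightarrow>
            card {y :: real poly. polynomial_solution (coeff_a x \<eta> j) y} = j) \<and>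
         (\<forall>x :: nat \<Rightarrow> complex. inj_on x {1..\<eta>} \<longrightarrow>
            card {y :: complex poly. polynomial_solution (coeff_a x \<eta> j) y} = j)"
  by (intro conjI allI impI card_polynomial_solutions_coeff_a[OF assms(2,3)])

end
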